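(* Let $F \subseteq \mathbb{N}$ be a finite nonempty set with $\min F \geq 3$. Then $Q_{U(F,5)} > 1$.
   Context: For a nonzero integer $N$, $\mathrm{rad}(N)$ denotes the largest square-free positive divisor of $N$. For $a = (a_1,\ldots,a_n) \in \mathbb{Z}^n$ with all $a_i \neq 0$, the quality of $a$ is $q(a) = \frac{\log(\max\{|a_1|,\ldots,|a_n|\})}{\log \mathrm{rad}(a_1 \cdots a_n)}$. For a set $A$ of such $n$-tuples, $Q_A$ denotes the limit superior of $q(a)$ over $a \in A$ (i.e. $\inf_{S \subseteq A \text{ finite}} \sup_{a \in A \setminus S} q(a)$). For a finite set $F \subseteq \mathbb{N}$, $U(F,5)$ is the set of all $(a_1,\ldots,a_5) \in \mathbb{Z}^5$ such that: (i) $\gcd(a_i,a_j) = 1$ for all $1 \leq i < j \leq 5$; (ii) $a_1 + \cdots + a_5 = 0$; (iii) there are no $b_1,\ldots,b_5 \in \{-1,0,1\}$ and indices $i,j$ with $b_i = 0$, $b_j = 1$ and $\sum_{k=1}^5 b_k a_k = 0$; (iv) none of $a_1,\ldots,a_5$ is a multiple of any element of $F$. *)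

theory Defs
  imports Complex_Main "HOL-Library.Extended_Real" "HOL-Computational_Algebra.Squarefree"
begin

definition rad :: "int \<Rightarrow> int" where
  "rad N = Max {d. 0 < d \<and> squarefree d \<and> d dvd N}"

(* Integer n-tuples are lists of length n; the entry a_i of the mathematical text is a ! (i - 1). *)

definition quality :: "int list \<Rightarrow> real" where
  "quality a = ln (real_of_int (Max (abs ` set a))) / ln (real_of_int (rad (prod_list a)))"

(* Extended-real valued, so that unbounded qualities give \<infinity> and a finite A gives -\<infinity>. *)

definition limsup_quality :: "int list set \<Rightarrow> ereal" where
  "limsup_quality A = (INF S\<in>{S. finite S \<and> S \<subseteq> A}. SUP a\<in>A - S. ereal (quality a))"

definition U :: "nat set \<Rightarrow> nat \<Rightarrow> int list set" where
  "U F n = {a. length a = n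
     \<and> (\<forall>i j. i < j \<and> j < n \<longrightarrow> gcd (a ! i) (a ! j) = 1)
     \<and> (\<Sum>k<n. a ! k) = 0
     \<and> \<not> (\<exists>b :: nat \<Rightarrow> int. (\<forall>k<n. b k \<in> {-1, 0, 1})
            \<and> (\<exists>i<n. \<exists>j<n. b i = 0 \<and> b j = 1)
            \<and> (\<Sum>k<n. b k * a ! k) = 0)
     \<and> (\<forall>k<n. \<forall>f\<in>F. \<not> int f dvd a ! k)}"

(* The qualities of elements of U F n are meaningful: no entry vanishes. *)

lemma U_nth_nonzero:
  assumes a: "a \<in> U F n" and n: "2 \<le> n" and i: "i < n"
  shows "a ! i \<noteq> 0"
proof
  assume 0: "a ! i = 0"
  define b :: "nat \<Rightarrow> int" where "b k = (if k = i then 1 else 0)" for k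
  define j :: nat where "j = (if i = 0 then 1 else 0)"
  have "j < n" "b j = 0" "b i = 1" using n by (auto simp: b_def j_def)
  moreover have "\<forall>k<n. b k \<in> {-1, 0, 1}" by (simp add: b_def)
  moreover have "(\<Sum>k<n. b k * a ! k) = 0"
    by (intro sum.neutral) (simp add: b_def 0)
  ultimately show False using a i unfolding U_def by blast
qed

end

theory Submission
  imports Defs "HOL-Computational_Algebra.Polynomial" "HOL-Number_Theory.Cong"
begin

text \<open>
  For \<open>n = 2 * j + 1\<close> and \<open>3 * \<beta> = 2 * j - 1\<close>, the polynomials \<open>(y + 1) ^ n - (y - 1) ^ n\<close> and
  \<open>2 * n * (y\<^sup>2 + \<beta>) ^ j\<close> in \<open>y\<^sup>2\<close> have the same two leading coefficients, so they differ by \<open>2 * h (y\<^sup>2)\<close>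
  with \<open>h\<close> (\<open>remainder\<close>) of degree at most \<open>j - 2\<close>. For every constant \<open>\<gamma>\<close> the five numbers \<open>(y + 1) ^ n\<close>,
  \<open>- (y - 1) ^ n\<close>, \<open>- 2 * n * (y\<^sup>2 + \<beta>) ^ j\<close>, \<open>2 * h (y\<^sup>2) - \<gamma>\<close>, \<open>\<gamma>\<close> thus sum to zero. When \<open>y + 1\<close> runs
  through powers of a fixed \<open>g\<close>, the radical of their product is \<open>O(y ^ (1 + 2 + 2 * (j - 2)))\<close>, that is,
  \<open>O(y ^ (n - 2))\<close>, while their maximum is at least \<open>(y + 1) ^ n\<close>, so the quality is eventually at least
  \<open>n / (n - 1)\<close>. A vanishing signed subsum is excluded because, once the
  second number is eliminated by means of the zero sum, the first and the third dominate the numbers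
  after them and the last two are coprime.

  Every element of \<open>F\<close> is divisible by 4 or shares a factor with a fixed odd number \<open>P\<close>. For
  \<open>j = 3 * P - 1\<close>, \<open>\<beta> = 2 * P - 1\<close>, a suitable \<open>\<gamma>\<close> and \<open>y\<close> divisible by a suitable modulus, the five
  numbers are pairwise coprime, coprime to \<open>P\<close> and not divisible by 4.
\<close>

section \<open>Radical, quality and limit superior\<close>

lemma prod_list_U_nonzero:
  assumes "a \<in> U F n" "2 \<le> n"
  shows "prod_list a \<noteq> 0"
proof -
  have "length a = n" using assms(1) by (simp add: U_def)
  thus ?thesis using U_nth_nonzero[OF assms] by (auto simp: prod_list_zero_iff in_set_conv_nth)
qed

lemma squarefree_dvdI:
  fixes a b :: "'a :: factorial_semiring"
  assumes "squarefree a" and dvd: "\<And>p. prime p \<Longrightarrow> p dvd a \<Longrightarrow> p dvd b"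
  shows "a dvd b"
proof (cases "b = 0")
  case False
  have "a \<noteq> 0" using assms(1) by auto
  thus ?thesis
  proof (rule multiplicity_le_imp_dvd)
    fix p :: 'a assume "prime p"
    have "multiplicity p a \<le> 1"
      using assms(1) \<open>a \<noteq> 0\<close> \<open>prime p\<close> by (simp add: squarefree_factorial_semiring'')
    moreover have "1 \<le> multiplicity p b" if "p dvd a"
      using dvd[OF \<open>prime p\<close> that] \<open>prime p\<close> False by (simp add: Suc_le_eq prime_multiplicity_gt_zero_iff)
    ultimately show "multiplicity p a \<le> multiplicity p b"
      by (cases "p dvd a") (auto simp: not_dvd_imp_multiplicity_0)
  qed
qed simp

lemma finite_squarefree_divisors:
  fixes N :: int
  assumes "N \<noteq> 0"
  shows "finite {d. 0 < d \<and> squarefree d \<and> d dvd N}"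
  using finite_divisors_int[OF assms] by (rule rev_finite_subset) auto

lemma rad_ge:
  assumes "N \<noteq> 0" "0 < d" "squarefree d" "d dvd N"
  shows "d \<le> rad N"
  unfolding rad_def using assms by (intro Max_ge finite_squarefree_divisors) auto

lemma rad_le:
  assumes "N \<noteq> 0" "M \<noteq> 0" and prime_dvd: "\<And>p. prime p \<Longrightarrow> p dvd N \<Longrightarrow> p dvd M"
  shows "rad N \<le> \<bar>M\<bar>"
proof -
  have "rad N \<in> {d. 0 < d \<and> squarefree d \<and> d dvd N}"
    unfolding rad_def
  proof (rule Max_in)
    have "1 \<in> {d. 0 < d \<and> squarefree d \<and> d dvd N}" by simp
    thus "{d. 0 < d \<and> squarefree d \<and> d dvd N} \<noteq> {}" by blast
  qed (rule finite_squarefree_divisors[OF assms(1)])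
  hence "squarefree (rad N)" "rad N dvd N" by simp_all
  hence "rad N dvd M" using prime_dvd by (blast intro: squarefree_dvdI dvd_trans)
  thus ?thesis using dvd_imp_le_int[OF assms(2)] by fastforce
qed

lemma quality_ge:
  fixes x :: int
  assumes "1 < x" and power_le: "x ^ n \<le> Max (abs ` set a)"
    and "1 < rad (prod_list a)" and rad_le: "rad (prod_list a) \<le> x ^ m"
  shows "real n / real m \<le> quality a"
proof -
  let ?max = "real_of_int (Max (abs ` set a))" and ?rad = "real_of_int (rad (prod_list a))"
  have ln_x: "0 < ln (real_of_int x)" using assms(1) by simp
  have "real n * ln x = ln (real_of_int (x ^ n))" using assms(1) by (simp add: ln_realpow)
  also have "\<dots> \<le> ln ?max"
    using power_le assms(1) by (intro ln_mono) (simp_all del: of_int_power)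
  finally have numerator: "real n * ln x \<le> ln ?max" .
  have "ln ?rad \<le> ln (real_of_int (x ^ m))"
    using rad_le assms(1,3) by (intro ln_mono) (simp_all del: of_int_power)
  also have "\<dots> = real m * ln x" using assms(1) by (simp add: ln_realpow)
  finally have denominator: "ln ?rad \<le> real m * ln x" .
  have "real n / real m = (real n * ln x) / (real m * ln x)" using ln_x by simp
  also have "\<dots> \<le> ln ?max / ln ?rad"
    using numerator denominator assms(3) ln_x
    by (intro frac_le order_trans[OF _ numerator]) simp_all
  finally show ?thesis unfolding quality_def .
qed

lemma limsup_quality_ge:
  assumes "infinite {a \<in> A. r \<le> quality a}"
  shows "ereal r \<le> limsup_quality A"
  unfolding limsup_quality_def
proof (rule INF_greatest)
  fix S assume "S \<in> {S. finite S \<and> S \<subseteq> A}"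
  hence "\<not> {a \<in> A. r \<le> quality a} \<subseteq> S" using assms finite_subset by blast
  then obtain a where "a \<in> A - S" "r \<le> quality a" by blast
  thus "ereal r \<le> (SUP a\<in>A - S. ereal (quality a))" by (intro SUP_upper2[of a]) simp_all
qed

section \<open>Integer polynomials\<close>

lemma eventually_poly_pos:
  fixes p :: "int poly"
  assumes "0 < lead_coeff p"
  shows "\<forall>\<^sub>F x in at_top. 0 < poly p x"
  using assms
proof (induction p)
  case (pCons a p)
  show ?case
  proof (cases "p = 0")
    case False
    hence "\<forall>\<^sub>F x in at_top. 0 < poly p x" using pCons by simp
    with eventually_gt_at_top[of "\<bar>a\<bar>"] show ?thesis
    proof eventually_elim
      case (elim x)
      hence "x * 1 \<le> x * poly p x" by (intro mult_left_mono) linarith+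
      thus ?case using elim(1) by simp
    qed
  qed (use pCons.prems in simp)
qed simp

lemma eventually_abs_poly_less:
  fixes p q :: "int poly"
  assumes "degree p < degree q"
  shows "\<forall>\<^sub>F x in at_top. K * \<bar>poly p x\<bar> < \<bar>poly q x\<bar>"
proof -
  have "q \<noteq> 0" using assms by auto
  have "degree (smult (K\<^sup>2) (p\<^sup>2)) \<le> degree p * 2"
    using degree_smult_le degree_power_le order_trans by blast
  also have "\<dots> < degree (q\<^sup>2)" using assms \<open>q \<noteq> 0\<close> by (simp add: degree_power_eq)
  finally have "lead_coeff (- smult (K\<^sup>2) (p\<^sup>2) + q\<^sup>2) = lead_coeff (q\<^sup>2)"
    by (intro lead_coeff_add_le) simp
  moreover have "0 < lead_coeff (q\<^sup>2)" using \<open>q \<noteq> 0\<close> by (simp add: lead_coeff_power)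
  ultimately have "\<forall>\<^sub>F x in at_top. 0 < poly (- smult (K\<^sup>2) (p\<^sup>2) + q\<^sup>2) x"
    by (intro eventually_poly_pos) simp
  thus ?thesis
  proof eventually_elim
    case (elim x)
    hence "(K * \<bar>poly p x\<bar>)\<^sup>2 < \<bar>poly q x\<bar>\<^sup>2" by (simp add: power_mult_distrib)
    thus ?case by (rule power2_less_imp_less) simp
  qed
qed

lemma cong_poly:
  fixes p :: "'a :: unique_euclidean_ring poly"
  assumes "[a = b] (mod m)"
  shows "[poly p a = poly p b] (mod m)"
  by (induction p) (simp_all add: cong_add cong_mult assms)

section \<open>Vanishing signed subsums\<close>

lemma dominant_coefficient_eq_0:
  fixes a d :: "'a \<Rightarrow> int"
  assumes zero: "e * z + (\<Sum>k\<in>A. d k * a k) = 0"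
    and d_le: "\<And>k. k \<in> A \<Longrightarrow> \<bar>d k\<bar> \<le> M" and dominant: "M * (\<Sum>k\<in>A. \<bar>a k\<bar>) < \<bar>z\<bar>"
  shows "e = 0"
proof (rule ccontr)
  assume "e \<noteq> 0"
  hence "\<bar>z\<bar> \<le> \<bar>e * z\<bar>" using mult_right_mono[of 1 "\<bar>e\<bar>" "\<bar>z\<bar>"] by (simp add: abs_mult)
  also have "\<bar>e * z\<bar> = \<bar>\<Sum>k\<in>A. d k * a k\<bar>" using zero by linarith
  also have "\<dots> \<le> (\<Sum>k\<in>A. \<bar>d k * a k\<bar>)" by (rule sum_abs)
  also have "\<dots> \<le> (\<Sum>k\<in>A. M * \<bar>a k\<bar>)"
    by (intro sum_mono) (simp add: abs_mult d_le mult_right_mono)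
  finally show False using dominant by (simp add: sum_distrib_left)
qed

lemma signed_coefficients_equal:
  fixes a b :: "nat \<Rightarrow> int"
  assumes b_values: "\<And>k. k < 5 \<Longrightarrow> b k \<in> {-1, 0, 1}"
    and sum_a: "(\<Sum>k<5. a k) = 0" and sum_ba: "(\<Sum>k<5. b k * a k) = 0"
    and dominant_0: "2 * (\<bar>a 2\<bar> + \<bar>a 3\<bar> + \<bar>a 4\<bar>) < \<bar>a 0\<bar>"
    and dominant_2: "2 * (\<bar>a 3\<bar> + \<bar>a 4\<bar>) < \<bar>a 2\<bar>"
    and coprime: "coprime (a 3) (a 4)" and a_4: "3 \<le> \<bar>a 4\<bar>"
    and "k < 5"
  shows "b k = b 1"
proof -
  define d where "d k = b k - b 1" for k
  have d_le: "\<bar>d k\<bar> \<le> 2" if "k < 5" for k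
    using b_values[OF that] b_values[of 1] unfolding d_def by auto
  have "(\<Sum>k<5. d k * a k) = (\<Sum>k<5. b k * a k) - b 1 * (\<Sum>k<5. a k)"
    by (simp add: d_def left_diff_distrib sum_subtractf sum_distrib_left)
  hence zero: "d 0 * a 0 + d 2 * a 2 + d 3 * a 3 + d 4 * a 4 = 0"
    using sum_a sum_ba by (simp add: d_def numeral_eq_Suc)
  have "d 0 = 0"
    by (rule dominant_coefficient_eq_0[where z = "a 0" and A = "{2, 3, 4}"
          and d = d and a = a and M = 2])
      (use zero d_le dominant_0 in auto)
  moreover have "d 2 = 0"
    by (rule dominant_coefficient_eq_0[where z = "a 2" and A = "{3, 4}"
          and d = d and a = a and M = 2])
      (use zero \<open>d 0 = 0\<close> d_le dominant_2 in auto)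
  ultimately have zero_3_4: "d 3 * a 3 = - d 4 * a 4" using zero by simp
  hence "a 4 dvd d 3"
    using coprime by (metis coprime_commute coprime_dvd_mult_left_iff dvd_triv_right)
  hence "d 3 = 0" using d_le[of 3] a_4 dvd_imp_le_int[of "d 3" "a 4"] by fastforce
  moreover from this have "d 4 = 0" using zero_3_4 a_4 by auto
  moreover have "k \<in> {0, 1, 2, 3, 4}" using \<open>k < 5\<close> by auto
  ultimately show ?thesis using \<open>d 0 = 0\<close> \<open>d 2 = 0\<close> by (auto simp: d_def)
qed

lemma mem_U_5I:
  assumes coprime: "sorted_wrt coprime [a\<^sub>0, a\<^sub>1, a\<^sub>2, a\<^sub>3, a\<^sub>4]"
    and sum: "sum_list [a\<^sub>0, a\<^sub>1, a\<^sub>2, a\<^sub>3, a\<^sub>4] = 0"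
    and dominant: "2 * (\<bar>a\<^sub>2\<bar> + \<bar>a\<^sub>3\<bar> + \<bar>a\<^sub>4\<bar>) < \<bar>a\<^sub>0\<bar>" "2 * (\<bar>a\<^sub>3\<bar> + \<bar>a\<^sub>4\<bar>) < \<bar>a\<^sub>2\<bar>" "3 \<le> \<bar>a\<^sub>4\<bar>"
    and not_dvd: "\<And>f z. f \<in> F \<Longrightarrow> z \<in> set [a\<^sub>0, a\<^sub>1, a\<^sub>2, a\<^sub>3, a\<^sub>4] \<Longrightarrow> \<not> int f dvd z"
  shows "[a\<^sub>0, a\<^sub>1, a\<^sub>2, a\<^sub>3, a\<^sub>4] \<in> U F 5" (is "?a \<in> _")
proof -
  have sum_nth: "(\<Sum>k<5. ?a ! k) = 0" using sum by (simp add: numeral_eq_Suc)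
  have "\<not> (\<exists>b :: nat \<Rightarrow> int. (\<forall>k<5. b k \<in> {-1, 0, 1})
      \<and> (\<exists>i<5. \<exists>j<5. b i = 0 \<and> b j = 1) \<and> (\<Sum>k<5. b k * ?a ! k) = 0)"
  proof clarify
    fix b :: "nat \<Rightarrow> int" and i j :: nat
    assume b_values: "\<forall>k<5. b k \<in> {-1, 0, 1}" and b_sum: "(\<Sum>k<5. b k * ?a ! k) = 0"
      and "i < 5" "j < 5" "b i = 0" "b j = 1"
    have "b k = b 1" if "k < 5" for k
      using b_values coprime dominant that
      by (intro signed_coefficients_equal[OF _ sum_nth b_sum]) simp_all
    from this[OF \<open>i < 5\<close>] this[OF \<open>j < 5\<close>] show False using \<open>b i = 0\<close> \<open>b j = 1\<close> by simp
  qed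
  moreover have "\<forall>i j. i < j \<and> j < 5 \<longrightarrow> gcd (?a ! i) (?a ! j) = 1"
    using coprime unfolding sorted_wrt_iff_nth_less by (simp add: coprime_iff_gcd_eq_1)
  moreover have "\<forall>k<5. \<forall>f\<in>F. \<not> int f dvd ?a ! k"
    using not_dvd nth_mem[of _ ?a] by simp
  ultimately show ?thesis using sum_nth unfolding U_def by simp
qed

section \<open>Approximating a difference of odd powers\<close>

lemma odd_power_diff:
  fixes y :: "'a :: comm_ring_1"
  shows "(y + 1) ^ (2 * j + 1) - (y - 1) ^ (2 * j + 1)
    = 2 * (\<Sum>i\<le>j. of_nat ((2 * j + 1) choose (2 * i)) * (y\<^sup>2) ^ i)"
proof -
  let ?n = "2 * j + 1"
  have "(y + 1) ^ ?n - (y - 1) ^ ?n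
      = (\<Sum>k\<le>Suc (2 * j). of_nat (?n choose k) * y ^ k * (1 - (- 1) ^ (?n - k)))"
    using binomial_ring[of y 1 ?n] binomial_ring[of y "- 1" ?n]
    by (simp add: sum_subtractf[symmetric] right_diff_distrib)
  also have "\<dots> = (\<Sum>i\<le>j. 2 * (of_nat (?n choose (2 * i)) * (y\<^sup>2) ^ i))"
    unfolding sum.in_pairs_0
    by (intro sum.cong refl) (auto simp: power_mult uminus_power_if)
  finally show ?thesis by (simp add: sum_distrib_left)
qed

locale odd_power_approximation =
  fixes j :: nat and \<beta> :: int
  assumes j_ge: "2 \<le> j" and three_beta: "3 * \<beta> = 2 * int j - 1"
begin

definition n :: nat where "n = 2 * j + 1"

definition remainder :: "int poly" where
  "remainder = smult (int n) ([:\<beta>, 1:] ^ j) - (\<Sum>i\<le>j. monom (int (n choose (2 * i))) i)"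

definition residual :: "int \<Rightarrow> int poly" where
  "residual \<gamma> = smult 2 remainder - [:\<gamma>:]"

definition quintuple :: "int \<Rightarrow> int \<Rightarrow> int list" where
  "quintuple \<gamma> y = [(y + 1) ^ n, - ((y - 1) ^ n), - (2 * int n * (y\<^sup>2 + \<beta>) ^ j),
     poly (residual \<gamma>) (y\<^sup>2), \<gamma>]"

lemma beta_pos: "0 < \<beta>"
  using j_ge three_beta by linarith

lemma n_ge: "5 \<le> n"
  using j_ge by (simp add: n_def)

lemma odd_n: "odd n"
  by (simp add: n_def)

lemma n_eq: "int n = 3 * \<beta> + 2"
  using three_beta by (simp add: n_def)

lemma coeff_remainder:
  assumes "i \<le> j"
  shows "coeff remainder i = int n * int (j choose i) * \<beta> ^ (j - i) - int (n choose (2 * i))"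
  using assms by (simp add: remainder_def coeff_sum coeff_linear_poly_power)

lemma n_choose_3: "int (n choose 3) = int n * int j * \<beta>"
proof -
  have "3 * (n choose 3) = n * (2 * j choose 2)"
    using binomial_absorption[of 2 n] by (simp add: numeral_eq_Suc n_def)
  also have "2 * j choose 2 = j * (2 * j - 1)" by (simp add: choose_two)
  finally have "3 * int (n choose 3) = int n * (int j * int (2 * j - 1))"
    by (metis of_nat_mult of_nat_numeral)
  also have "int (2 * j - 1) = 3 * \<beta>" using j_ge three_beta by (simp add: of_nat_diff)
  finally show ?thesis by simp
qed

lemma degree_remainder_le: "degree remainder \<le> j - 2"
proof (rule degree_le, intro allI impI)
  fix i assume "j - 2 < i"
  then consider (leading) "i = j" | (subleading) "i = j - 1" | (beyond) "j < i" by linarith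
  thus "coeff remainder i = 0"
  proof cases
    case leading
    have "n choose (2 * j) = n" by (simp add: n_def)
    thus ?thesis using leading by (simp add: coeff_remainder)
  next
    case subleading
    have "n choose (2 * (j - 1)) = n choose 3"
      using j_ge binomial_symmetric[of "2 * (j - 1)" n] by (simp add: n_def algebra_simps)
    moreover have "j choose (j - 1) = j"
      using j_ge binomial_symmetric[of 1 j] by simp
    ultimately show ?thesis using subleading j_ge by (simp add: coeff_remainder n_choose_3)
  next
    case beyond
    hence "degree ([:\<beta>, 1:] ^ j) < i" by (simp add: degree_linear_power)
    thus ?thesis using beyond by (simp add: remainder_def coeff_sum coeff_eq_0)
  qed
qed

lemma degree_residual_le: "degree (residual \<gamma>) \<le> j - 2"
  unfolding residual_def
  using degree_remainder_le by (intro degree_diff_le) simp_all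

lemma power_diff_eq:
  "(y + 1) ^ n - (y - 1) ^ n = 2 * int n * (y\<^sup>2 + \<beta>) ^ j - 2 * poly remainder (y\<^sup>2)"
proof -
  have "(y + 1) ^ n - (y - 1) ^ n = 2 * (\<Sum>i\<le>j. int (n choose (2 * i)) * (y\<^sup>2) ^ i)"
    unfolding n_def by (rule odd_power_diff)
  thus ?thesis by (simp add: remainder_def poly_sum poly_monom right_diff_distrib add.commute)
qed

lemma poly_residual: "poly (residual \<gamma>) v = 2 * poly remainder v - \<gamma>"
  by (simp add: residual_def)

lemma sum_list_quintuple: "sum_list (quintuple \<gamma> y) = 0"
  using power_diff_eq[of y] by (simp add: quintuple_def poly_residual)

lemma eventually_quintuple_dominance:
  "\<forall>\<^sub>F y in at_top.
     2 * (\<bar>2 * int n * (y\<^sup>2 + \<beta>) ^ j\<bar> + \<bar>poly (residual \<gamma>) (y\<^sup>2)\<bar> + \<bar>\<gamma>\<bar>) < \<bar>(y + 1) ^ n\<bar> \<and>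
     2 * (\<bar>poly (residual \<gamma>) (y\<^sup>2)\<bar> + \<bar>\<gamma>\<bar>) < \<bar>2 * int n * (y\<^sup>2 + \<beta>) ^ j\<bar>"
proof -
  define first where "first = [:1, 1::int:] ^ n"
  define third where "third = smult (2 * int n) ([:\<beta>, 0, 1:] ^ j)"
  define fourth where "fourth = residual \<gamma> \<circ>\<^sub>p [:0, 0, 1:]"
  have degree_first: "degree first = 2 * j + 1"
    unfolding first_def degree_linear_power n_def ..
  have degree_third: "degree third = 2 * j"
    using n_ge by (simp add: third_def degree_power_eq)
  have degree_fourth: "degree fourth < 2 * j"
    using degree_residual_le[of \<gamma>] j_ge by (simp add: fourth_def degree_pcompose)
  have "\<forall>\<^sub>F y in at_top. 6 * \<bar>poly third y\<bar> < \<bar>poly first y\<bar>"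
    "\<forall>\<^sub>F y in at_top. 6 * \<bar>poly fourth y\<bar> < \<bar>poly first y\<bar>"
    "\<forall>\<^sub>F y in at_top. 6 * \<bar>poly [:\<gamma>:] y\<bar> < \<bar>poly first y\<bar>"
    "\<forall>\<^sub>F y in at_top. 4 * \<bar>poly fourth y\<bar> < \<bar>poly third y\<bar>"
    "\<forall>\<^sub>F y in at_top. 4 * \<bar>poly [:\<gamma>:] y\<bar> < \<bar>poly third y\<bar>"
    using degree_first degree_third degree_fourth j_ge
    by (simp_all only: eventually_abs_poly_less degree_pCons_0)
  thus ?thesis
  proof eventually_elim
    case (elim y)
    have "poly first y = (y + 1) ^ n" "poly third y = 2 * int n * (y\<^sup>2 + \<beta>) ^ j"
      "poly fourth y = poly (residual \<gamma>) (y\<^sup>2)"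
      by (simp_all add: first_def third_def fourth_def poly_pcompose power2_eq_square add.commute)
    thus ?case using elim by simp
  qed
qed

lemma eventually_quintuple_mem_U:
  assumes "3 \<le> \<bar>\<gamma>\<bar>"
  shows "\<forall>\<^sub>F y in at_top. sorted_wrt coprime (quintuple \<gamma> y) \<longrightarrow>
    (\<forall>f\<in>F. \<forall>z\<in>set (quintuple \<gamma> y). \<not> int f dvd z) \<longrightarrow> quintuple \<gamma> y \<in> U F 5"
  using eventually_quintuple_dominance[of \<gamma>]
proof eventually_elim
  case (elim y)
  show ?case
  proof (intro impI)
    assume coprime: "sorted_wrt coprime (quintuple \<gamma> y)"
      and not_dvd: "\<forall>f\<in>F. \<forall>z\<in>set (quintuple \<gamma> y). \<not> int f dvd z"
    show "quintuple \<gamma> y \<in> U F 5"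
      unfolding quintuple_def
    proof (rule mem_U_5I; (fold quintuple_def)?)
      show "sorted_wrt coprime (quintuple \<gamma> y)" by (rule coprime)
      show "sum_list (quintuple \<gamma> y) = 0" by (rule sum_list_quintuple)
      show "\<not> int f dvd z" if "f \<in> F" "z \<in> set (quintuple \<gamma> y)" for f z
        using not_dvd that by blast
    qed (use elim assms in \<open>simp_all only: abs_minus_cancel\<close>)
  qed
qed

lemma rad_quintuple_le:
  assumes nonzero: "prod_list (quintuple \<gamma> y) \<noteq> 0" and "g \<noteq> 0"
    and primes: "prime_factors (y + 1) \<subseteq> prime_factors g"
  shows "rad (prod_list (quintuple \<gamma> y))
    \<le> \<bar>2 * int n * g * \<gamma> * ((y - 1) * (y\<^sup>2 + \<beta>) * poly (residual \<gamma>) (y\<^sup>2))\<bar>" (is "_ \<le> \<bar>?bound\<bar>")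
proof (rule rad_le[OF nonzero])
  show "?bound \<noteq> 0" using nonzero \<open>g \<noteq> 0\<close> n_ge j_ge by (auto simp: quintuple_def)
  fix p :: int assume p: "prime p" "p dvd prod_list (quintuple \<gamma> y)"
  hence "p dvd y + 1 \<or> p dvd y - 1 \<or> p dvd 2 \<or> p dvd int n \<or> p dvd y\<^sup>2 + \<beta>
      \<or> p dvd poly (residual \<gamma>) (y\<^sup>2) \<or> p dvd \<gamma>"
    by (auto simp: quintuple_def prime_dvd_mult_iff dest: prime_dvd_power)
  moreover have "p dvd g" if "p dvd y + 1"
  proof -
    have "y + 1 \<noteq> 0" using nonzero n_ge by (auto simp: quintuple_def)
    hence "p \<in> prime_factors (y + 1)" using p(1) that by (simp add: in_prime_factors_iff)
    thus ?thesis using primes by auto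
  qed
  ultimately show "p dvd ?bound" by (auto intro: dvd_mult dvd_mult2)
qed

lemma eventually_rad_quintuple_le:
  assumes "g \<noteq> 0"
  shows "\<forall>\<^sub>F y in at_top. prod_list (quintuple \<gamma> y) \<noteq> 0 \<longrightarrow>
    prime_factors (y + 1) \<subseteq> prime_factors g \<longrightarrow>
    rad (prod_list (quintuple \<gamma> y)) \<le> (y + 1) ^ (n - 1)"
proof -
  define bound where "bound = smult (2 * int n * g * \<gamma>)
    ([:-1, 1:] * [:\<beta>, 0, 1:] * (residual \<gamma> \<circ>\<^sub>p [:0, 0, 1:]))"
  have poly_bound: "poly bound y
      = 2 * int n * g * \<gamma> * ((y - 1) * (y\<^sup>2 + \<beta>) * poly (residual \<gamma>) (y\<^sup>2))" for y
    by (simp add: bound_def poly_pcompose power2_eq_square algebra_simps)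
  have "degree bound \<le> degree [:-1, 1::int:] + degree [:\<beta>, 0, 1:]
      + degree (residual \<gamma> \<circ>\<^sub>p [:0, 0, 1:])"
    unfolding bound_def
    by (intro order_trans[OF degree_smult_le] order_trans[OF degree_mult_le] add_mono order_refl
        degree_mult_le)
  also have "\<dots> < n - 1"
    using degree_residual_le[of \<gamma>] j_ge by (simp add: degree_pcompose n_def)
  finally have "degree bound < degree ([:1, 1::int:] ^ (n - 1))" by (simp add: degree_linear_power)
  hence "\<forall>\<^sub>F y in at_top. 1 * \<bar>poly bound y\<bar> < \<bar>poly ([:1, 1:] ^ (n - 1)) y\<bar>"
    by (rule eventually_abs_poly_less)
  with eventually_gt_at_top[of 0] show ?thesis
  proof eventually_elim
    case (elim y)
    hence "\<bar>poly bound y\<bar> \<le> (y + 1) ^ (n - 1)" by (simp add: add.commute)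
    thus ?case using rad_quintuple_le[OF _ assms] unfolding poly_bound by (blast intro: order_trans)
  qed
qed

lemma eventually_quality_quintuple_ge:
  assumes "g \<noteq> 0"
  shows "\<forall>\<^sub>F y in at_top. prod_list (quintuple \<gamma> y) \<noteq> 0 \<longrightarrow>
    prime_factors (y + 1) \<subseteq> prime_factors g \<longrightarrow>
    real n / real (n - 1) \<le> quality (quintuple \<gamma> y)"
  using eventually_gt_at_top[of 0] eventually_rad_quintuple_le[OF assms, of \<gamma>]
proof eventually_elim
  case (elim y)
  show ?case
  proof (intro impI quality_ge[of "y + 1"])
    assume nonzero: "prod_list (quintuple \<gamma> y) \<noteq> 0"
      and primes: "prime_factors (y + 1) \<subseteq> prime_factors g"
    show "rad (prod_list (quintuple \<gamma> y)) \<le> (y + 1) ^ (n - 1)" using elim(2) nonzero primes by simp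
    have "2 dvd prod_list (quintuple \<gamma> y)" by (simp add: quintuple_def)
    hence "2 \<le> rad (prod_list (quintuple \<gamma> y))"
      using nonzero by (intro rad_ge squarefree_prime) simp_all
    thus "1 < rad (prod_list (quintuple \<gamma> y))" by simp
    show "(y + 1) ^ n \<le> Max (abs ` set (quintuple \<gamma> y))"
      using elim(1) by (intro Max_ge) (auto simp: quintuple_def)
  qed (use elim(1) in simp)
qed

end

section \<open>Pairwise coprime quintuples\<close>

locale coprime_quintuples = odd_power_approximation +
  fixes P :: nat
  assumes odd_P: "odd P" and j_eq: "int j = 3 * int P - 1"
begin

lemma beta_eq: "\<beta> = 2 * int P - 1"
  using three_beta j_eq by simp

lemma odd_beta: "odd \<beta>"
  by (simp add: beta_eq)

lemma even_j: "even j"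
  using odd_P j_eq by presburger

definition \<delta> :: int where "\<delta> = int n * \<beta> ^ j - 1"

text \<open>
  Modulo \<open>P\<close> we have \<open>n = - 1\<close>, \<open>\<beta> = - 1\<close> and \<open>\<delta> = - 2\<close>, so \<open>\<gamma>\<close> solves \<open>\<gamma> = - 1\<close> modulo \<open>n * \<beta> * \<delta>\<close>
  together with \<open>\<gamma> = - 2\<close> modulo \<open>P\<close>.
\<close>
definition \<gamma> :: int where "\<gamma> = int n * \<beta> * \<delta> * ((int P + 1) div 2) - 1"

text \<open>
  The values of \<open>residual \<gamma>\<close> at \<open>1\<close> and \<open>- \<beta>\<close> are the residues of \<open>poly (residual \<gamma>) (y\<^sup>2)\<close> modulo
  \<open>y\<^sup>2 - 1 = (y + 1) * (y - 1)\<close> and modulo \<open>y\<^sup>2 + \<beta>\<close>.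
\<close>
definition modulus :: int where
  "modulus = 2 * int P * int n * \<gamma> * poly (residual \<gamma>) 1 * poly (residual \<gamma>) (- \<beta>)"

lemma poly_remainder_0: "poly remainder 0 = \<delta>"
  by (simp add: poly_0_coeff_0 coeff_remainder \<delta>_def)

lemma poly_residual_0: "poly (residual \<gamma>) 0 = 2 * \<delta> - \<gamma>"
  by (simp add: poly_residual poly_remainder_0)

lemma even_delta: "even \<delta>"
  using odd_n odd_beta by (simp add: \<delta>_def)

lemma odd_gamma: "odd \<gamma>"
  using even_delta by (simp add: \<gamma>_def)

lemma odd_residual: "odd (poly (residual \<gamma>) v)"
  using odd_gamma by (simp add: poly_residual)

lemma gamma_ge: "3 \<le> \<gamma>"
proof -
  have "5 * 1 \<le> int n * \<beta> ^ j"
    using n_ge beta_pos by (intro mult_mono) (simp_all add: int_one_le_iff_zero_less)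
  hence "4 \<le> \<delta>" by (simp add: \<delta>_def)
  moreover have "1 * 1 \<le> int n * \<beta>" using n_ge beta_pos by (intro mult_mono) simp_all
  ultimately have "1 * 4 \<le> int n * \<beta> * \<delta>" by (intro mult_mono) simp_all
  moreover have "1 \<le> (int P + 1) div 2" using j_ge j_eq by simp
  ultimately have "4 * 1 \<le> int n * \<beta> * \<delta> * ((int P + 1) div 2)" by (intro mult_mono) simp_all
  thus ?thesis by (simp add: \<gamma>_def)
qed

lemma modulus_nonzero: "modulus \<noteq> 0"
  using odd_pos[OF odd_P] n_ge gamma_ge odd_residual[of 1] odd_residual[of "- \<beta>"]
  by (auto simp: modulus_def)

lemma n_cong: "[int n = - 1] (mod int P)"
  by (simp add: cong_iff_dvd_diff n_eq beta_eq)

lemma beta_cong: "[\<beta> = - 1] (mod int P)"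
  by (simp add: cong_iff_dvd_diff beta_eq)

lemma delta_cong: "[\<delta> = - 2] (mod int P)"
proof -
  have "[\<delta> = - 1 * (- 1) ^ j - 1] (mod int P)"
    unfolding \<delta>_def by (intro cong_diff cong_mult cong_pow n_cong beta_cong cong_refl)
  thus ?thesis using even_j by simp
qed

lemma gamma_cong: "[\<gamma> = - 2] (mod int P)"
proof -
  have "[\<gamma> = - 1 * - 1 * - 2 * ((int P + 1) div 2) - 1] (mod int P)"
    unfolding \<gamma>_def
    by (intro cong_diff cong_mult n_cong beta_cong delta_cong cong_refl)
  also have "- 1 * - 1 * - 2 * ((int P + 1) div 2) - 1 = - int P - 2"
    using odd_P by (auto elim!: oddE)
  also have "[- int P - 2 = - 2] (mod int P)" by (simp add: cong_iff_dvd_diff)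
  finally show ?thesis .
qed

lemma residual_0_cong: "[poly (residual \<gamma>) 0 = - 2] (mod int P)"
proof -
  have "[poly (residual \<gamma>) 0 = 2 * - 2 - - 2] (mod int P)"
    unfolding poly_residual_0 by (intro cong_diff cong_mult delta_cong gamma_cong cong_refl)
  thus ?thesis by simp
qed

lemma
  shows coprime_n_P: "coprime (int n) (int P)"
    and coprime_beta_P: "coprime \<beta> (int P)"
    and coprime_gamma_P: "coprime \<gamma> (int P)"
    and coprime_residual_0_P: "coprime (poly (residual \<gamma>) 0) (int P)"
  using odd_P coprime_cong_cong_left[OF n_cong] coprime_cong_cong_left[OF beta_cong]
    coprime_cong_cong_left[OF gamma_cong] coprime_cong_cong_left[OF residual_0_cong]
  by simp_all

lemma
  assumes "m dvd int n * \<beta> * \<delta>"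
  shows coprime_gamma: "coprime \<gamma> m" and coprime_gamma_add_2: "coprime (\<gamma> + 2) m"
proof -
  have minus_1: "[\<gamma> = - 1] (mod m)"
    using assms by (simp add: \<gamma>_def cong_iff_dvd_diff)
  thus "coprime \<gamma> m" by (simp add: coprime_cong_cong_left)
  have "[\<gamma> + 2 = - 1 + 2] (mod m)" by (intro cong_add minus_1 cong_refl)
  thus "coprime (\<gamma> + 2) m" by (simp add: coprime_cong_cong_left)
qed

lemma coprime_residual_0:
  assumes "m dvd int n * \<beta>"
  shows "coprime (poly (residual \<gamma>) 0) m"
proof -
  have "int n * \<beta> dvd int n * \<beta> ^ j" using j_ge by (intro mult_dvd_mono) simp_all
  with assms have "m dvd int n * \<beta> ^ j" by (rule dvd_trans)
  hence "m dvd 2 * (int n * \<beta> ^ j)" by (rule dvd_mult)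
  hence "[poly (residual \<gamma>) 0 = - (\<gamma> + 2)] (mod m)"
    by (simp add: cong_iff_dvd_diff poly_residual_0 \<delta>_def algebra_simps)
  moreover have "coprime (- (\<gamma> + 2)) m"
    using coprime_gamma_add_2[of m] assms unfolding coprime_minus_left_iff by simp
  ultimately show ?thesis by (simp only: coprime_cong_cong_left)
qed

lemma coprime_residual_0_gamma: "coprime (poly (residual \<gamma>) 0) \<gamma>"
proof -
  have "[poly (residual \<gamma>) 0 = 2 * \<delta>] (mod \<gamma>)" by (simp add: cong_iff_dvd_diff poly_residual_0)
  moreover have "coprime (2 * \<delta>) \<gamma>"
    using coprime_gamma[of \<delta>] odd_gamma by (simp add: coprime_commute)
  ultimately show ?thesis by (simp only: coprime_cong_cong_left)
qed

lemma
  shows even_modulus: "even modulus"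
    and P_dvd_modulus: "int P dvd modulus"
    and two_P_dvd_modulus: "2 * int P dvd modulus"
    and n_dvd_modulus: "int n dvd modulus"
    and gamma_dvd_modulus: "\<gamma> dvd modulus"
    and residual_1_dvd_modulus: "poly (residual \<gamma>) 1 dvd modulus"
    and residual_minus_beta_dvd_modulus: "poly (residual \<gamma>) (- \<beta>) dvd modulus"
  unfolding modulus_def by (auto intro: dvd_mult dvd_mult2)

context
  fixes v :: int
  assumes modulus_dvd: "modulus dvd v"
begin

lemma v_cong:
  assumes "m dvd modulus"
  shows "[v = 0] (mod m)"
  using dvd_trans[OF assms modulus_dvd] by (simp only: cong_0_iff)

lemma coprime_pred:
  assumes "m dvd modulus"
  shows "coprime (v - 1) m"
proof -
  have "[v - 1 = 0 - 1] (mod m)" by (intro cong_diff v_cong assms cong_refl)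
  thus ?thesis by (simp add: coprime_cong_cong_left)
qed

lemma coprime_add_beta:
  assumes "m dvd modulus" "coprime \<beta> m"
  shows "coprime (v + \<beta>) m"
proof -
  have "[v + \<beta> = 0 + \<beta>] (mod m)" by (intro cong_add v_cong assms cong_refl)
  thus ?thesis using assms(2) by (simp add: coprime_cong_cong_left)
qed

lemma coprime_residual:
  assumes "m dvd modulus" "coprime (poly (residual \<gamma>) 0) m"
  shows "coprime (poly (residual \<gamma>) v) m"
  using coprime_cong_cong_left[OF cong_poly[OF v_cong[OF assms(1)]]] assms(2) by simp

lemma coprime_pred_add_beta: "coprime (v - 1) (v + \<beta>)"
proof -
  have "[v + \<beta> = 2 * int P] (mod (v - 1))" by (simp add: cong_iff_dvd_diff beta_eq)
  thus ?thesis using coprime_pred[OF two_P_dvd_modulus] by (simp only: coprime_cong_cong_right)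
qed

lemma coprime_pred_residual: "coprime (v - 1) (poly (residual \<gamma>) v)"
proof -
  have "[poly (residual \<gamma>) v = poly (residual \<gamma>) 1] (mod (v - 1))"
    by (intro cong_poly) (simp add: cong_iff_dvd_diff)
  thus ?thesis using coprime_pred[OF residual_1_dvd_modulus] by (simp only: coprime_cong_cong_right)
qed

lemma coprime_add_beta_residual: "coprime (v + \<beta>) (poly (residual \<gamma>) v)"
proof -
  have "[poly (residual \<gamma>) (- \<beta>) = poly (residual \<gamma>) 0] (mod \<beta>)"
    by (intro cong_poly) (simp add: cong_iff_dvd_diff)
  hence "coprime \<beta> (poly (residual \<gamma>) (- \<beta>))"
    using coprime_residual_0[of \<beta>] by (simp add: coprime_cong_cong_right coprime_commute)
  hence "coprime (v + \<beta>) (poly (residual \<gamma>) (- \<beta>))"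
    by (rule coprime_add_beta[OF residual_minus_beta_dvd_modulus])
  moreover have "[poly (residual \<gamma>) v = poly (residual \<gamma>) (- \<beta>)] (mod (v + \<beta>))"
    by (intro cong_poly) (simp add: cong_iff_dvd_diff)
  ultimately show ?thesis by (simp only: coprime_cong_cong_right)
qed

end

context
  fixes y :: int
  assumes modulus_dvd: "modulus dvd y"
begin

lemma modulus_dvd_square: "modulus dvd y\<^sup>2"
  using modulus_dvd by (simp add: power2_eq_square)

lemma even_y: "even y"
  using even_modulus modulus_dvd by (rule dvd_trans)

lemma coprime_succ_pred: "coprime (y + 1) (y - 1)"
proof -
  have "[y + 1 = 2] (mod (y - 1))" by (simp add: cong_iff_dvd_diff)
  thus ?thesis using even_y by (simp add: coprime_cong_cong_left)
qed

lemma coprime_linear_factors: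
  assumes "coprime (y\<^sup>2 - 1) m"
  shows "coprime (y + 1) m" "coprime (y - 1) m"
proof -
  have "y\<^sup>2 - 1 = (y + 1) * (y - 1)" by (simp add: power2_eq_square algebra_simps)
  thus "coprime (y + 1) m" "coprime (y - 1) m" using assms by simp_all
qed

lemma coprime_linear_factors_modulus:
  assumes "m dvd modulus"
  shows "coprime (y + 1) m" "coprime (y - 1) m"
  using coprime_linear_factors[OF coprime_pred[OF modulus_dvd_square assms]] .

lemma sorted_wrt_coprime_quintuple: "sorted_wrt coprime (quintuple \<gamma> y)"
proof -
  note square = modulus_dvd_square
  have "coprime (y\<^sup>2 + \<beta>) \<gamma>"
    using coprime_gamma[of \<beta>]
    by (intro coprime_add_beta square gamma_dvd_modulus) (simp add: coprime_commute)
  moreover have "coprime (poly (residual \<gamma>) (y\<^sup>2)) \<gamma>"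
    by (rule coprime_residual[OF square gamma_dvd_modulus coprime_residual_0_gamma])
  moreover have "coprime (poly (residual \<gamma>) (y\<^sup>2)) (int n)"
    by (rule coprime_residual[OF square n_dvd_modulus], rule coprime_residual_0) simp
  moreover have "coprime \<gamma> (int n)" by (intro coprime_gamma) simp
  moreover have "coprime 2 \<gamma>" "coprime 2 (poly (residual \<gamma>) (y\<^sup>2))"
    using odd_gamma odd_residual by simp_all
  ultimately show ?thesis
    using coprime_succ_pred coprime_linear_factors_modulus[OF even_modulus]
      coprime_linear_factors_modulus[OF n_dvd_modulus]
      coprime_linear_factors_modulus[OF gamma_dvd_modulus]
      coprime_linear_factors[OF coprime_pred_add_beta[OF square]]
      coprime_linear_factors[OF coprime_pred_residual[OF square]]
      coprime_add_beta_residual[OF square]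
    by (simp add: quintuple_def coprime_commute)
qed

lemma coprime_quintuple_P:
  assumes "z \<in> set (quintuple \<gamma> y)"
  shows "coprime z (int P)"
proof -
  have "coprime (y\<^sup>2 + \<beta>) (int P)"
    by (intro coprime_add_beta modulus_dvd_square P_dvd_modulus coprime_beta_P)
  moreover have "coprime (poly (residual \<gamma>) (y\<^sup>2)) (int P)"
    by (rule coprime_residual[OF modulus_dvd_square P_dvd_modulus coprime_residual_0_P])
  ultimately show ?thesis
    using assms odd_P coprime_linear_factors_modulus[OF P_dvd_modulus] coprime_n_P coprime_gamma_P
    by (auto simp: quintuple_def)
qed

lemma not_4_dvd_quintuple:
  assumes "z \<in> set (quintuple \<gamma> y)"
  shows "\<not> 4 dvd z"
proof (cases "z = - (2 * int n * (y\<^sup>2 + \<beta>) ^ j)")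
  case True
  have "odd (y\<^sup>2 + \<beta>)" using even_y odd_beta by simp
  hence "\<not> 2 * 2 dvd 2 * (int n * (y\<^sup>2 + \<beta>) ^ j)"
    using odd_n by (simp only: dvd_mult_cancel_left) simp
  thus ?thesis using True by (simp add: mult.assoc)
next
  case False
  hence "odd z"
    using assms even_y odd_gamma odd_residual by (auto simp: quintuple_def)
  thus ?thesis by (meson dvd_trans even_numeral)
qed

lemma not_dvd_quintuple:
  assumes "4 dvd f \<or> \<not> coprime f P" and z: "z \<in> set (quintuple \<gamma> y)"
  shows "\<not> int f dvd z"
proof
  assume f_dvd: "int f dvd z"
  show False
    using assms(1)
  proof
    assume "4 dvd f"
    hence "4 dvd int f" by presburger
    thus False using not_4_dvd_quintuple[OF z] f_dvd dvd_trans by blast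
  next
    assume "\<not> coprime f P"
    moreover have "coprime (int f) (int P)"
      using coprime_quintuple_P[OF z] f_dvd coprime_divisors[of "int f" z "int P" "int P"] by simp
    ultimately show False by simp
  qed
qed

end

lemma eventually_quintuple_mem_U_quality_ge:
  assumes "g \<noteq> 0" and F_not_coprime: "\<And>f. f \<in> F \<Longrightarrow> 4 dvd f \<or> \<not> coprime f P"
  shows "\<forall>\<^sub>F y in at_top. modulus dvd y \<longrightarrow> prime_factors (y + 1) \<subseteq> prime_factors g \<longrightarrow>
    quintuple \<gamma> y \<in> {a \<in> U F 5. real n / real (n - 1) \<le> quality a}"
proof -
  have "3 \<le> \<bar>\<gamma>\<bar>" using gamma_ge by simp
  from eventually_quintuple_mem_U[OF this, of F] eventually_quality_quintuple_ge[OF assms(1), of \<gamma>]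
  show ?thesis
  proof eventually_elim
    case (elim y)
    show ?case
    proof (intro impI CollectI conjI)
      assume modulus_dvd: "modulus dvd y" and primes: "prime_factors (y + 1) \<subseteq> prime_factors g"
      show "quintuple \<gamma> y \<in> U F 5"
        using elim(1) sorted_wrt_coprime_quintuple[OF modulus_dvd]
          not_dvd_quintuple[OF modulus_dvd F_not_coprime] by blast
      hence "prod_list (quintuple \<gamma> y) \<noteq> 0" by (rule prod_list_U_nonzero) simp
      thus "real n / real (n - 1) \<le> quality (quintuple \<gamma> y)" using elim(2) primes by blast
    qed
  qed
qed

lemma limsup_quality_U_gt_1:
  assumes F_not_coprime: "\<And>f. f \<in> F \<Longrightarrow> 4 dvd f \<or> \<not> coprime f P"
  shows "1 < limsup_quality (U F 5)"
proof -
  let ?A = "{a \<in> U F 5. real n / real (n - 1) \<le> quality a}"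
  define g where "g = \<bar>modulus\<bar> + 1"
  define a where "a k = quintuple \<gamma> (g ^ k - 1)" for k
  have g_ge: "2 \<le> g" using modulus_nonzero by (simp add: g_def)
  hence "g \<noteq> 0" by simp
  from eventually_quintuple_mem_U_quality_ge[OF this F_not_coprime] obtain B where mem:
    "quintuple \<gamma> y \<in> ?A"
    if "B \<le> y" "modulus dvd y" "prime_factors (y + 1) \<subseteq> prime_factors g" for y
    unfolding eventually_at_top_linorder by blast
  have "a k \<in> ?A" if "nat B \<le> k" for k
    unfolding a_def
  proof (rule mem)
    have "int k < 2 ^ k" by (rule of_nat_less_two_power)
    also have "\<dots> \<le> g ^ k" using g_ge by (intro power_mono) simp_all
    finally show "B \<le> g ^ k - 1" using that by linarith
    have "[g ^ k = 1 ^ k] (mod modulus)" by (intro cong_pow) (simp add: g_def cong_iff_dvd_diff)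
    thus "modulus dvd g ^ k - 1" by (simp add: cong_iff_dvd_diff)
    show "prime_factors (g ^ k - 1 + 1) \<subseteq> prime_factors g"
      using g_ge by (auto simp: in_prime_factors_iff dest: prime_dvd_power)
  qed
  hence "a ` {nat B..} \<subseteq> ?A" by auto
  moreover have "inj a"
  proof (rule injI)
    fix k l assume "a k = a l"
    hence "g ^ (k * n) = g ^ (l * n)" by (simp add: a_def quintuple_def power_mult)
    thus "k = l" using g_ge n_ge by (simp add: power_inject_exp)
  qed
  hence "infinite (a ` {nat B..})"
    by (simp add: finite_image_iff inj_on_subset infinite_Ici)
  ultimately have "infinite ?A" by (rule infinite_super)
  hence "ereal (real n / real (n - 1)) \<le> limsup_quality (U F 5)" by (rule limsup_quality_ge)
  moreover have "1 < ereal (real n / real (n - 1))" using n_ge by simp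
  ultimately show ?thesis by (rule less_le_trans[rotated])
qed

end

lemma ex_odd_divisor_gt_1:
  fixes f :: nat
  assumes "3 \<le> f" "\<not> 4 dvd f"
  shows "\<exists>m>1. odd m \<and> m dvd f"
proof (cases "even f")
  case True
  then obtain m where "f = 2 * m" by auto
  thus ?thesis using assms by (intro exI[of _ m]) auto
next
  case False
  thus ?thesis using assms(1) by (intro exI[of _ f]) auto
qed

lemma obtain_odd_not_coprime:
  fixes F :: "nat set"
  assumes "finite F" and F_ge: "\<And>f. f \<in> F \<Longrightarrow> 3 \<le> f"
  obtains P where "odd P" "\<And>f. f \<in> F \<Longrightarrow> 4 dvd f \<or> \<not> coprime f P"
proof -
  let ?G = "{f \<in> F. \<not> 4 dvd f}"
  have "\<forall>f\<in>?G. \<exists>m. 1 < m \<and> odd m \<and> m dvd f" using F_ge ex_odd_divisor_gt_1 by blast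
  then obtain m where m: "\<forall>f\<in>?G. 1 < m f \<and> odd (m f) \<and> m f dvd f" by (rule bchoice[THEN exE])
  have "finite ?G" using assms(1) by simp
  show thesis
  proof (rule that[of "prod m ?G"])
    show "odd (prod m ?G)" using m \<open>finite ?G\<close> by (auto simp: even_prod_iff)
    show "4 dvd f \<or> \<not> coprime f (prod m ?G)" if "f \<in> F" for f
    proof (cases "4 dvd f")
      case False
      hence "f \<in> ?G" using that by simp
      hence "m f dvd prod m ?G" by (rule dvd_prodI[OF \<open>finite ?G\<close>])
      moreover have "1 < m f" "m f dvd f" using m \<open>f \<in> ?G\<close> by blast+
      ultimately show ?thesis using not_coprimeI[of "m f" f "prod m ?G"] by simp
    qed simp
  qed
qed

theorem theorem2p3:
  fixes F :: "nat set"
  assumes "finite F" and "F \<noteq> {}" and "Min F \<ge> 3"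
  shows "limsup_quality (U F 5) > 1"
proof -
  have "3 \<le> f" if "f \<in> F" for f
    using assms(3) Min_le[OF assms(1) that] by simp
  with assms(1) obtain P where P: "odd P" "\<And>f. f \<in> F \<Longrightarrow> 4 dvd f \<or> \<not> coprime f P"
    using obtain_odd_not_coprime by blast
  interpret coprime_quintuples "3 * P - 1" "2 * int P - 1" P
    using P(1) by unfold_locales (auto elim!: oddE)
  show ?thesis using P(2) by (rule limsup_quality_U_gt_1)
qed

end
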